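(* Let $(K,d)$ be a compact geodesic space with a convex metric. Then, in the lion-and-man game on $(K,d)$, Lion has a winning non-anticipative discrete-time strategy. That is, for every $\varepsilon>0$ there is a non-anticipative discrete-time strategy of Lion such that, for all initial positions $x^0,y^0\in K$ of Lion and Man and every admissible trajectory $M$ of Man with $M(0)=y^0$, the trajectory $L$ of Lion generated by the strategy satisfies $d\bigl(L(t),M(t)\bigr)<\varepsilon$ for some $t\in[0,+\infty)$.
   Context: Let $(K,d)$ be a metric space. A geodesic path joining $A\in K$ to $B\in K$ is a map $\gamma\colon[a,b]\subset\mathbb{R}\to K$ with $\gamma(a)=A$, $\gamma(b)=B$ and $d(\gamma(t),\gamma(t'))=|t-t'|$ for all $t,t'\in[a,b]$. $(K,d)$ is a geodesic space if every pair of points of $K$ can be joined by a geodesic path (not necessarily unique). The metric of a geodesic space $(K,d)$ is convex if for every point $z\in K$, every geodesic path $\gamma\colon[0,l]\to K$ and every $s\in[0,1]$ one has $d(z,\gamma(sl))\le(1-s)\,d(z,\gamma(0))+s\,d(z,\gamma(l))$. Lion-and-man game: admissible trajectories of each player are the 1-Lipschitz maps $[0,+\infty)\to K$ starting at that player's initial position. The number $\varepsilon>0$ is fixed in advance; Lion wins if $d(L(t),M(t))<\varepsilon$ at some time $t\in[0,+\infty)$. A non-anticipative discrete-time strategy of Lion is given by a step $h>0$ and a map assigning to each initial position $x^0\in K$ of Lion and each admissible trajectory $M$ of Man an admissible trajectory $L=\Lambda(x^0,M)$ of Lion with $L(0)=x^0$, such that Lion's motion on each interval $[ih,(i+1)h]$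 is decided at time $ih$ from what has been observed so far: for each $i\in\mathbb{N}\cup\{0\}$, if $M$ and $M'$ coincide on $[0,ih]$, then $\Lambda(x^0,M)$ and $\Lambda(x^0,M')$ coincide on $[0,(i+1)h]$. *)

theory Defs
  imports "HOL-Analysis.Analysis"
begin

(* A metric space (K, d) is a set K of points of a type in class metric_space, with the
   restricted metric. All paths are required to stay in K. A map on a real interval is a
   function on all of real, of which only the values on that interval matter. *)

definition geodesic_path :: "'a::metric_space set \<Rightarrow> real \<Rightarrow> real \<Rightarrow> (real \<Rightarrow> 'a) \<Rightarrow> bool" where
  "geodesic_path K a b \<gamma> \<longleftrightarrow>
     a \<le> b \<and> \<gamma> ` {a..b} \<subseteq> K \<and>
     (\<forall>t\<in>{a..b}. \<forall>t'\<in>{a..b}. dist (\<gamma> t) (\<gamma> t') = \<bar>t - t'\<bar>)"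

definition geodesic_space :: "'a::metric_space set \<Rightarrow> bool" where
  "geodesic_space K \<longleftrightarrow>
     (\<forall>A\<in>K. \<forall>B\<in>K. \<exists>a b \<gamma>. geodesic_path K a b \<gamma> \<and> \<gamma> a = A \<and> \<gamma> b = B)"

definition convex_metric :: "'a::metric_space set \<Rightarrow> bool" where
  "convex_metric K \<longleftrightarrow>
     (\<forall>z\<in>K. \<forall>l \<gamma>. geodesic_path K 0 l \<gamma> \<longrightarrow>
        (\<forall>s\<in>{0..1}. dist z (\<gamma> (s * l)) \<le> (1 - s) * dist z (\<gamma> 0) + s * dist z (\<gamma> l)))"

definition admissible :: "'a::metric_space set \<Rightarrow> 'a \<Rightarrow> (real \<Rightarrow> 'a) \<Rightarrow> bool" where
  "admissible K x f \<longleftrightarrow> f ` {0..} \<subseteq> K \<and> 1-lipschitz_on {0..} f \<and> f 0 = x"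

(* If M and M' agree on {0..}, the last conjunct, taken for all i, makes the two responses
   agree on {0..}; so values of M at negative times have no influence. *)

definition discrete_time_strategy ::
    "'a::metric_space set \<Rightarrow> real \<Rightarrow> ('a \<Rightarrow> (real \<Rightarrow> 'a) \<Rightarrow> (real \<Rightarrow> 'a)) \<Rightarrow> bool" where
  "discrete_time_strategy K h \<Lambda> \<longleftrightarrow>
     h > 0 \<and>
     (\<forall>x\<in>K. \<forall>y\<in>K. \<forall>M. admissible K y M \<longrightarrow> admissible K x (\<Lambda> x M)) \<and>
     (\<forall>x\<in>K. \<forall>y\<in>K. \<forall>y'\<in>K. \<forall>M M'. admissible K y M \<longrightarrow> admissible K y' M' \<longrightarrow>
        (\<forall>i::nat. (\<forall>t\<in>{0..real i * h}. M t = M' t) \<longrightarrow>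
           (\<forall>t\<in>{0..(real i + 1) * h}. \<Lambda> x M t = \<Lambda> x M' t)))"

end

theory Submission
  imports Defs
begin

text \<open>
  Lion uses simple pursuit with a step \<open>h < \<epsilon>\<close>: at each time \<open>i h\<close> he looks where Man is and runs
  for time \<open>h\<close> along a geodesic towards that point, stopping early if he reaches it.

  The reason that this wins is that in a convex metric overlapping geodesics join to a geodesic: if
  \<open>y\<close> lies between \<open>x\<close> and \<open>z\<close>, and \<open>z\<close> between \<open>y\<close> and \<open>w\<close>, with \<open>y \<noteq> z\<close>, then \<open>z\<close> lies between
  \<open>x\<close> and \<open>w\<close> (\<open>convex_metric_betweenness\<close>). Compactness turns this into a statement about
  sequences of quadruples for which the two hypotheses hold in the limit
  (\<open>convex_metric_betweenness_limit\<close>).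

  In a pursuit the distance from Lion to Man at the times \<open>i h\<close> never increases, so it has a
  limit \<open>D\<close>. If Lion never wins, then \<open>D \<ge> \<epsilon> > h\<close>. In the limit Man can keep his distance only by
  running straight away from Lion at full speed, so successive positions of the two players line
  up, and betweenness extends this from one step to any number of steps: the distance from
  Lion's position at step \<open>k\<close> to Man's position at step \<open>k + n\<close> tends to \<open>D + n h\<close> as \<open>k\<close> grows,
  for every \<open>n\<close>. This is impossible in a bounded space (\<open>no_endless_pursuit\<close>).
\<close>

section \<open>Walking along geodesics\<close>

text \<open>
  If the ends are as far apart as the Lipschitz condition allows, the triangle inequality leaves
  no slack anywhere in between.
\<close>

lemma geodesic_pathI_lipschitz:
  assumes "0 \<le> l" and "\<gamma> ` {0..l} \<subseteq> K" and lip: "1-lipschitz_on {0..l} \<gamma>"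
    and ends: "dist (\<gamma> 0) (\<gamma> l) = l"
  shows "geodesic_path K 0 l \<gamma>"
proof -
  have *: "dist (\<gamma> s) (\<gamma> t) = t - s" if "0 \<le> s" "s \<le> t" "t \<le> l" for s t
  proof -
    have "dist (\<gamma> 0) (\<gamma> s) \<le> s" "dist (\<gamma> s) (\<gamma> t) \<le> t - s" "dist (\<gamma> t) (\<gamma> l) \<le> l - t"
      using lipschitz_onD[OF lip, of 0 s] lipschitz_onD[OF lip, of s t]
        lipschitz_onD[OF lip, of t l] that
      by (auto simp: dist_real_def)
    moreover have "dist (\<gamma> 0) (\<gamma> l) \<le> dist (\<gamma> 0) (\<gamma> s) + dist (\<gamma> s) (\<gamma> t) + dist (\<gamma> t) (\<gamma> l)"
      by metric
    ultimately show ?thesis using ends by linarith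
  qed
  have "dist (\<gamma> s) (\<gamma> t) = \<bar>s - t\<bar>" if "s \<in> {0..l}" "t \<in> {0..l}" for s t
    using *[of s t] *[of t s] that by (cases "s \<le> t") (auto simp: dist_commute)
  then show ?thesis using assms by (auto simp: geodesic_path_def)
qed

definition chosen_geodesic :: "'a::metric_space set \<Rightarrow> 'a \<Rightarrow> 'a \<Rightarrow> real \<Rightarrow> 'a" where
  "chosen_geodesic K A B =
     (SOME p. geodesic_path K 0 (dist A B) p \<and> p 0 = A \<and> p (dist A B) = B)"

text \<open>Whoever walks stays at the destination after having reached it.\<close>

definition walk :: "'a::metric_space set \<Rightarrow> 'a \<Rightarrow> 'a \<Rightarrow> real \<Rightarrow> 'a" where
  "walk K A B t = chosen_geodesic K A B (min t (dist A B))"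

context
  fixes K :: "'a::metric_space set" and A B :: 'a
  assumes geo: "geodesic_space K" and A: "A \<in> K" and B: "B \<in> K"
begin

lemma chosen_geodesic:
  "geodesic_path K 0 (dist A B) (chosen_geodesic K A B)"
  "chosen_geodesic K A B 0 = A"
  "chosen_geodesic K A B (dist A B) = B"
proof -
  obtain a b \<gamma> where \<gamma>: "geodesic_path K a b \<gamma>" "\<gamma> a = A" "\<gamma> b = B"
    using geo A B unfolding geodesic_space_def by blast
  then have ab: "a \<le> b" "dist A B = b - a"
    by (auto simp: geodesic_path_def)
  have "geodesic_path K 0 (dist A B) (\<lambda>t. \<gamma> (a + t))"
    using \<gamma>(1) ab by (auto simp: geodesic_path_def image_subset_iff)
  then have "geodesic_path K 0 (dist A B) (\<lambda>t. \<gamma> (a + t)) \<and> \<gamma> (a + 0) = A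
      \<and> \<gamma> (a + dist A B) = B"
    using \<gamma> ab by simp
  from someI[where P = "\<lambda>p. geodesic_path K 0 (dist A B) p \<and> p 0 = A \<and> p (dist A B) = B",
      OF this]
  show "geodesic_path K 0 (dist A B) (chosen_geodesic K A B)"
    "chosen_geodesic K A B 0 = A"
    "chosen_geodesic K A B (dist A B) = B"
    unfolding chosen_geodesic_def by auto
qed

lemma walk_0: "walk K A B 0 = A"
  by (simp add: walk_def chosen_geodesic)

lemma walk_in: "0 \<le> t \<Longrightarrow> walk K A B t \<in> K"
  using chosen_geodesic(1) by (auto simp: walk_def geodesic_path_def image_subset_iff)

lemma dist_walk:
  assumes "0 \<le> s" "0 \<le> t"
  shows "dist (walk K A B s) (walk K A B t) = \<bar>min s (dist A B) - min t (dist A B)\<bar>"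
  using chosen_geodesic(1) assms by (auto simp: walk_def geodesic_path_def)

lemma walk_lipschitz: "1-lipschitz_on {0..} (walk K A B)"
  by (rule lipschitz_onI) (auto simp: dist_walk dist_real_def)

lemma walk_end: "walk K A B (dist A B) = B"
  by (simp add: walk_def chosen_geodesic)

lemma dist_walk_start: "0 \<le> t \<Longrightarrow> dist A (walk K A B t) = min t (dist A B)"
  using dist_walk[of 0 t] by (simp add: walk_0)

lemma dist_walk_end: "0 \<le> t \<Longrightarrow> dist (walk K A B t) B = dist A B - min t (dist A B)"
  using dist_walk[of t "dist A B"] by (simp add: walk_end)

end

section \<open>Betweenness in a convex metric\<close>

lemma geodesic_through_between:
  fixes K :: "'a::metric_space set"
  assumes geo: "geodesic_space K" and K: "x \<in> K" "y \<in> K" "z \<in> K"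
    and btw: "dist x y + dist y z = dist x z"
  obtains \<gamma> where "geodesic_path K 0 (dist x z) \<gamma>"
    "\<gamma> 0 = x" "\<gamma> (dist x y) = y" "\<gamma> (dist x z) = z"
proof
  let ?\<gamma> = "\<lambda>t. if t \<le> dist x y then walk K x y t else walk K y z (t - dist x y)"
  show 0: "?\<gamma> 0 = x" and "?\<gamma> (dist x y) = y"
    using geo K by (simp_all add: walk_0 walk_end)
  show 1: "?\<gamma> (dist x z) = z"
  proof (cases "dist x z \<le> dist x y")
    case True
    then have "dist y z \<le> 0" using btw by linarith
    then show ?thesis using walk_end[OF geo K(1,2)] by simp
  next
    case False
    moreover have "dist x z - dist x y = dist y z" using btw by linarith
    ultimately show ?thesis using walk_end[OF geo K(2,3)] by simp
  qed
  have "1-lipschitz_on {dist x y..dist x z} (\<lambda>t. walk K y z (t - dist x y))"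
  proof (rule lipschitz_onI)
    fix s t assume "s \<in> {dist x y..dist x z}" "t \<in> {dist x y..dist x z}"
    then show "dist (walk K y z (s - dist x y)) (walk K y z (t - dist x y)) \<le> 1 * dist s t"
      using lipschitz_onD[OF walk_lipschitz[OF geo K(2,3)], of "s - dist x y" "t - dist x y"]
      by (simp add: dist_real_def)
  qed simp
  moreover have "1-lipschitz_on {0..dist x y} (walk K x y)"
    using walk_lipschitz[OF geo K(1,2)] by (rule lipschitz_on_subset) auto
  ultimately have "1-lipschitz_on {0..dist x z} ?\<gamma>"
    using geo K by (intro lipschitz_on_concat) (auto simp: walk_0 walk_end)
  then show "geodesic_path K 0 (dist x z) ?\<gamma>"
  proof (intro geodesic_pathI_lipschitz)
    show "dist (?\<gamma> 0) (?\<gamma> (dist x z)) = dist x z"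
      unfolding 0 1 ..
  qed (use geo K in \<open>auto simp: walk_in\<close>)
qed

text \<open>
  Along a geodesic from \<open>x\<close> through \<open>y\<close> to \<open>z\<close> the distance to \<open>w\<close> is a convex function. It has
  slope \<open>-1\<close> on the nondegenerate piece from \<open>y\<close> to \<open>z\<close>, hence slope at most \<open>-1\<close> before it.
\<close>

lemma convex_metric_betweenness:
  fixes K :: "'a::metric_space set"
  assumes geo: "geodesic_space K" and conv: "convex_metric K"
    and K: "x \<in> K" "y \<in> K" "z \<in> K" "w \<in> K" and "y \<noteq> z"
    and xyz: "dist x y + dist y z = dist x z" and yzw: "dist y z + dist z w = dist y w"
  shows "dist x z + dist z w = dist x w"
proof -
  obtain \<gamma> where \<gamma>: "geodesic_path K 0 (dist x z) \<gamma>"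
    "\<gamma> 0 = x" "\<gamma> (dist x y) = y" "\<gamma> (dist x z) = z"
    using geodesic_through_between[OF geo K(1-3) xyz] .
  have yz: "dist y z > 0" using \<open>y \<noteq> z\<close> by simp
  then have xz: "dist x z > 0" using xyz zero_le_dist[of x y] by linarith
  define s where "s = dist x y / dist x z"
  have "dist x y \<le> dist x z" using xyz yz by linarith
  then have s: "s \<in> {0..1}" "s * dist x z = dist x y"
    using xz by (auto simp: s_def)
  have "dist w (\<gamma> (s * dist x z)) \<le> (1 - s) * dist w (\<gamma> 0) + s * dist w (\<gamma> (dist x z))"
    using conv K(4) \<gamma>(1) s(1) unfolding convex_metric_def by blast
  then have "dist y w \<le> (1 - s) * dist x w + s * dist z w"
    by (simp add: s \<gamma> dist_commute)
  then have "dist x z * dist y w \<le> dist x z * ((1 - s) * dist x w + s * dist z w)"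
    using xz by simp
  also have "\<dots> = (dist x z - s * dist x z) * dist x w + (s * dist x z) * dist z w"
    by (simp add: algebra_simps)
  also have "\<dots> = dist y z * dist x w + dist x y * dist z w"
    unfolding s(2) by (simp flip: xyz)
  finally have "dist y z * (dist x z + dist z w) \<le> dist y z * dist x w"
    by (simp add: algebra_simps flip: xyz yzw)
  then have "dist x z + dist z w \<le> dist x w"
    using yz by simp
  then show ?thesis using dist_triangle[of x w z] by linarith
qed

text \<open>
  If the conclusion failed, a subsequence of the quadruples would converge in \<open>K\<close> to a quadruple
  that violates betweenness.
\<close>

lemma convex_metric_betweenness_limit:
  fixes K :: "'a::metric_space set" and X Y Z W :: "nat \<Rightarrow> 'a"
  assumes comp: "compact K" and geo: "geodesic_space K" and conv: "convex_metric K"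
    and K: "\<And>k. X k \<in> K" "\<And>k. Y k \<in> K" "\<And>k. Z k \<in> K" "\<And>k. W k \<in> K"
    and XY: "(\<lambda>k. dist (X k) (Y k)) \<longlonglongrightarrow> a" and YZ: "(\<lambda>k. dist (Y k) (Z k)) \<longlonglongrightarrow> b"
    and "b > 0" and XZ: "(\<lambda>k. dist (X k) (Z k)) \<longlonglongrightarrow> a + b"
    and ZW: "(\<lambda>k. dist (Z k) (W k)) \<longlonglongrightarrow> c" and YW: "(\<lambda>k. dist (Y k) (W k)) \<longlonglongrightarrow> b + c"
  shows "(\<lambda>k. dist (X k) (W k)) \<longlonglongrightarrow> a + b + c"
proof (rule ccontr)
  assume "\<not> ?thesis"
  then obtain e where e: "e > 0"
    and "\<not> (\<forall>\<^sub>F k in sequentially. dist (dist (X k) (W k)) (a + b + c) < e)"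
    unfolding tendsto_iff by blast
  then have freq: "\<exists>\<^sub>F k in sequentially. \<not> dist (dist (X k) (W k)) (a + b + c) < e"
    by (simp add: frequently_def)
  then have "infinite {k. \<not> dist (dist (X k) (W k)) (a + b + c) < e}"
    unfolding frequently_cofinite[symmetric] cofinite_eq_sequentially .
  then obtain r :: "nat \<Rightarrow> nat" where r: "strict_mono r"
    "\<And>k. \<not> dist (dist (X (r k)) (W (r k))) (a + b + c) < e"
    using infinite_enumerate by blast
  have "seq_compact (K \<times> K \<times> K \<times> K)"
    using comp by (intro compact_imp_seq_compact compact_Times)
  moreover have "\<forall>k. (X (r k), Y (r k), Z (r k), W (r k)) \<in> K \<times> K \<times> K \<times> K"
    using K by auto
  ultimately obtain l q where l: "l \<in> K \<times> K \<times> K \<times> K" and q: "strict_mono q"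
    and lim: "((\<lambda>k. (X (r k), Y (r k), Z (r k), W (r k))) \<circ> q) \<longlonglongrightarrow> l"
    by (rule seq_compactE)
  obtain x y z w where l_eq: "l = (x, y, z, w)" by (cases l)
  define u where "u = r \<circ> q"
  have u: "strict_mono u" unfolding u_def using r(1) q by (rule strict_mono_o)
  have lims: "(\<lambda>k. X (u k)) \<longlonglongrightarrow> x" "(\<lambda>k. Y (u k)) \<longlonglongrightarrow> y" "(\<lambda>k. Z (u k)) \<longlonglongrightarrow> z"
    "(\<lambda>k. W (u k)) \<longlonglongrightarrow> w"
    using tendsto_fst[OF lim] tendsto_fst[OF tendsto_snd[OF lim]]
      tendsto_fst[OF tendsto_snd[OF tendsto_snd[OF lim]]]
      tendsto_snd[OF tendsto_snd[OF tendsto_snd[OF lim]]]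
    by (simp_all add: l_eq u_def o_def)
  have sub: "(\<lambda>k. f (u k)) \<longlonglongrightarrow> t" if "f \<longlonglongrightarrow> t" for f :: "nat \<Rightarrow> real" and t
    using LIMSEQ_subseq_LIMSEQ[OF that u] by (simp add: o_def)
  have "dist x y = a" "dist y z = b" "dist x z = a + b" "dist z w = c" "dist y w = b + c"
    using LIMSEQ_unique[OF tendsto_dist[OF lims(1,2)] sub[OF XY]]
      LIMSEQ_unique[OF tendsto_dist[OF lims(2,3)] sub[OF YZ]]
      LIMSEQ_unique[OF tendsto_dist[OF lims(1,3)] sub[OF XZ]]
      LIMSEQ_unique[OF tendsto_dist[OF lims(3,4)] sub[OF ZW]]
      LIMSEQ_unique[OF tendsto_dist[OF lims(2,4)] sub[OF YW]]
    by auto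
  then have "dist x w = a + b + c"
    using convex_metric_betweenness[OF geo conv, of x y z w] l l_eq \<open>b > 0\<close> by auto
  then have "(\<lambda>k. dist (X (u k)) (W (u k))) \<longlonglongrightarrow> a + b + c"
    using tendsto_dist[OF lims(1,4)] by simp
  then have "\<forall>\<^sub>F k in sequentially. dist (dist (X (u k)) (W (u k))) (a + b + c) < e"
    using e by (rule tendstoD)
  then show False using r(2) by (simp add: u_def)
qed

section \<open>A pursuit cannot last forever\<close>

text \<open>
  Here \<open>l i\<close> and \<open>m i\<close> are the positions of Lion and of Man after \<open>i\<close> steps of a pursuit in which
  Lion always makes a full step.
\<close>

lemma no_endless_pursuit:
  fixes K :: "'a::metric_space set" and l m :: "nat \<Rightarrow> 'a"
  assumes comp: "compact K" and geo: "geodesic_space K" and conv: "convex_metric K"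
    and lK: "\<And>i. l i \<in> K" and mK: "\<And>i. m i \<in> K"
    and "0 < h" "h < \<epsilon>" and far: "\<And>i. \<epsilon> \<le> dist (l i) (m i)"
    and step: "\<And>i. dist (l i) (l (Suc i)) \<le> h"
    and toward: "\<And>i. dist (l (Suc i)) (m i) = dist (l i) (m i) - h"
    and man: "\<And>i. dist (m i) (m (Suc i)) \<le> h"
  shows False
proof -
  have "decseq (\<lambda>i. dist (l i) (m i))"
  proof (rule decseq_SucI)
    show "dist (l (Suc i)) (m (Suc i)) \<le> dist (l i) (m i)" for i
      using dist_triangle[of "l (Suc i)" "m (Suc i)" "m i"] toward[of i] man[of i] by linarith
  qed
  then obtain D where D: "(\<lambda>i. dist (l i) (m i)) \<longlonglongrightarrow> D"
    using decseq_convergent[of _ 0] by (metis zero_le_dist)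
  have "D \<ge> \<epsilon>" using D far by (intro LIMSEQ_le_const) auto
  have D': "(\<lambda>i. dist (l (Suc i)) (m i)) \<longlonglongrightarrow> D - h"
    unfolding toward by (intro tendsto_intros D)
  have lower: "dist (l (Suc i)) (m (Suc i)) - dist (l (Suc i)) (m i) \<le> dist (m i) (m (Suc i))" for i
    by metric
  have man_lim: "(\<lambda>i. dist (m i) (m (Suc i))) \<longlonglongrightarrow> h"
  proof (rule tendsto_sandwich)
    show "(\<lambda>i. dist (l (Suc i)) (m (Suc i)) - dist (l (Suc i)) (m i)) \<longlonglongrightarrow> h"
      using tendsto_diff[OF LIMSEQ_Suc[OF D] D'] by simp
  qed (use lower man in auto)
  have lion_le: "dist (l k) (l (k + n)) \<le> real n * h" for k n
  proof (induction n)
    case (Suc n)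
    then show ?case
      using dist_triangle[of "l k" "l (Suc (k + n))" "l (k + n)"] step[of "k + n"]
      by (simp add: algebra_simps)
  qed simp
  \<comment> \<open>The positions \<open>l k\<close>, \<open>l (k + n + 1)\<close>, \<open>m (k + n)\<close>, \<open>m (k + n + 1)\<close> line up in the limit. The
     first three do because \<open>l (k + n + 1)\<close> is at most \<open>(n + 1) h\<close> from \<open>l k\<close> and within about
     \<open>D - h\<close> of \<open>m (k + n)\<close>, which is about \<open>D + n h\<close> away from \<open>l k\<close>. The middle two stay apart
     since \<open>D > h\<close>, so betweenness applies.\<close>
  have apart: "(\<lambda>k. dist (l k) (m (k + n))) \<longlonglongrightarrow> D + real n * h" for n
  proof (induction n)
    case (Suc n)
    have D_n: "(\<lambda>k. dist (l (Suc (k + n))) (m (k + n))) \<longlonglongrightarrow> D - h"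
      and DS_n: "(\<lambda>k. dist (l (Suc (k + n))) (m (Suc (k + n)))) \<longlonglongrightarrow> D"
      and man_n: "(\<lambda>k. dist (m (k + n)) (m (Suc (k + n)))) \<longlonglongrightarrow> h"
      using LIMSEQ_ignore_initial_segment[OF D', of n] LIMSEQ_ignore_initial_segment[OF D, of "Suc n"]
        LIMSEQ_ignore_initial_segment[OF man_lim, of n]
      by simp_all
    have lion: "(\<lambda>k. dist (l k) (l (Suc (k + n)))) \<longlonglongrightarrow> real (Suc n) * h"
    proof (rule tendsto_sandwich)
      show "\<forall>\<^sub>F k in sequentially. dist (l k) (m (k + n)) - dist (l (Suc (k + n))) (m (k + n))
          \<le> dist (l k) (l (Suc (k + n)))"
        by (intro always_eventually allI) metric
      show "\<forall>\<^sub>F k in sequentially. dist (l k) (l (Suc (k + n))) \<le> real (Suc n) * h"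
        using lion_le[of _ "Suc n"] by simp
      show "(\<lambda>k. dist (l k) (m (k + n)) - dist (l (Suc (k + n))) (m (k + n)))
          \<longlonglongrightarrow> real (Suc n) * h"
        using tendsto_diff[OF Suc.IH D_n] by (simp add: algebra_simps)
    qed simp
    have "(\<lambda>k. dist (l k) (m (Suc (k + n)))) \<longlonglongrightarrow> real (Suc n) * h + (D - h) + h"
      using Suc.IH DS_n \<open>h < \<epsilon>\<close> \<open>D \<ge> \<epsilon>\<close>
      by (intro convex_metric_betweenness_limit[OF comp geo conv lK lK mK mK lion D_n _ _ man_n])
        (auto simp: algebra_simps)
    then show ?case by (simp add: algebra_simps)
  qed (simp add: D)
  obtain C where C: "\<And>x y. x \<in> K \<Longrightarrow> y \<in> K \<Longrightarrow> dist x y \<le> C"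
    using compact_imp_bounded[OF comp] by (metis bounded_two_points)
  obtain n where "C < real n * h"
    using \<open>0 < h\<close> reals_Archimedean3 by blast
  moreover have "D + real n * h \<le> C"
    using apart C lK mK by (intro LIMSEQ_le_const2[OF apart]) auto
  ultimately show False using \<open>0 < h\<close> \<open>h < \<epsilon>\<close> \<open>D \<ge> \<epsilon>\<close> by linarith
qed

section \<open>The pursuit strategy\<close>

primrec pursuit_point ::
    "'a::metric_space set \<Rightarrow> real \<Rightarrow> 'a \<Rightarrow> (real \<Rightarrow> 'a) \<Rightarrow> nat \<Rightarrow> 'a" where
  "pursuit_point K h x M 0 = x"
| "pursuit_point K h x M (Suc i) = walk K (pursuit_point K h x M i) (M (real i * h)) h"

definition pursuit :: "'a::metric_space set \<Rightarrow> real \<Rightarrow> 'a \<Rightarrow> (real \<Rightarrow> 'a) \<Rightarrow> real \<Rightarrow> 'a" where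
  "pursuit K h x M t =
     (let i = nat \<lfloor>t / h\<rfloor> in walk K (pursuit_point K h x M i) (M (real i * h)) (t - real i * h))"

text \<open>
  The index \<open>\<lfloor>t / h\<rfloor>\<close> would be \<open>i + 1\<close> at the right end \<open>t = (i + 1) h\<close>; closed intervals give
  \<open>j \<le> i\<close> there too, which non-anticipation needs.
\<close>

lemma grid_interval_cover:
  fixes h t :: real
  assumes "0 < h" "0 \<le> t" "t \<le> (real i + 1) * h"
  obtains j where "j \<le> i" "real j * h \<le> t" "t \<le> (real j + 1) * h"
  using assms(3)
proof (induction i arbitrary: thesis)
  case 0
  then show ?case using \<open>0 \<le> t\<close> by (auto intro: "0"(1)[of 0])
next
  case (Suc i)
  show ?case
  proof (cases "t \<le> (real i + 1) * h")
    case True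
    then show ?thesis using Suc.IH Suc.prems(1) le_SucI by blast
  next
    case False
    then show ?thesis using Suc.prems(2) by (intro Suc.prems(1)[of "Suc i"]) (simp_all add: add.commute)
  qed
qed

context
  fixes K :: "'a::metric_space set" and h :: real and x y :: 'a and M :: "real \<Rightarrow> 'a"
  assumes geo: "geodesic_space K" and h: "0 < h" and x: "x \<in> K" and M: "admissible K y M"
begin

lemma man_in: "0 \<le> t \<Longrightarrow> M t \<in> K"
  using M by (auto simp: admissible_def)

lemma man_grid_in: "M (real i * h) \<in> K"
  using h by (simp add: man_in)

lemma pursuit_point_in: "pursuit_point K h x M i \<in> K"
  using h by (induction i) (auto simp: x man_grid_in walk_in[OF geo])

text \<open>
  The closed right end is covered too, where the walk of one step hands over to that of the next.
\<close>

lemma pursuit_on_step: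
  assumes "real i * h \<le> t" "t \<le> (real i + 1) * h"
  shows "pursuit K h x M t = walk K (pursuit_point K h x M i) (M (real i * h)) (t - real i * h)"
proof (cases "t = (real i + 1) * h")
  case True
  then have "t / h = of_nat (Suc i)" using h by simp
  then have "nat \<lfloor>t / h\<rfloor> = Suc i" by (simp only: floor_of_nat nat_int)
  moreover have "t - real (Suc i) * h = 0" "t - real i * h = h"
    using True by (simp_all add: algebra_simps)
  moreover have "walk K (pursuit_point K h x M (Suc i)) (M (real (Suc i) * h)) 0 =
      pursuit_point K h x M (Suc i)"
    by (rule walk_0[OF geo pursuit_point_in man_grid_in])
  ultimately show ?thesis
    unfolding pursuit_def Let_def by (simp only: pursuit_point.simps)
next
  case False
  then have "real i \<le> t / h" "t / h < real i + 1"
    using assms h by (auto simp: field_simps)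
  then have "\<lfloor>t / h\<rfloor> = int i" by (simp add: floor_eq_iff)
  then show ?thesis by (simp add: pursuit_def)
qed

lemma pursuit_at_grid: "pursuit K h x M (real i * h) = pursuit_point K h x M i"
  using pursuit_on_step[of i "real i * h"] h
  by (simp add: walk_0[OF geo pursuit_point_in man_grid_in])

lemma pursuit_in:
  assumes "0 \<le> t"
  shows "pursuit K h x M t \<in> K"
proof -
  obtain i where "t / h \<le> real i" using real_arch_simple by blast
  then have "t \<le> (real i + 1) * h" using h by (simp add: field_simps)
  then obtain j where "real j * h \<le> t" "t \<le> (real j + 1) * h"
    using grid_interval_cover[OF h assms] by blast
  then show ?thesis
    by (simp add: pursuit_on_step walk_in[OF geo pursuit_point_in man_grid_in])
qed

lemma pursuit_lipschitz: "1-lipschitz_on {0..} (pursuit K h x M)"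
proof -
  have piece: "1-lipschitz_on {real i * h..(real i + 1) * h} (pursuit K h x M)" for i
  proof (rule lipschitz_onI)
    fix s t
    assume s: "s \<in> {real i * h..(real i + 1) * h}" and t: "t \<in> {real i * h..(real i + 1) * h}"
    then have "dist (pursuit K h x M s) (pursuit K h x M t) \<le>
        1 * dist (s - real i * h) (t - real i * h)"
      using lipschitz_onD[OF walk_lipschitz[OF geo pursuit_point_in[of i] man_grid_in[of i]],
          of "s - real i * h" "t - real i * h"]
        pursuit_on_step[of i s] pursuit_on_step[of i t]
      by simp
    then show "dist (pursuit K h x M s) (pursuit K h x M t) \<le> 1 * dist s t"
      by (simp add: dist_real_def)
  qed simp
  have initial: "1-lipschitz_on {0..real n * h} (pursuit K h x M)" for n
  proof (induction n)
    case (Suc n)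
    from lipschitz_on_concat[OF this piece[of n] refl] show ?case by (simp add: add.commute)
  qed (simp add: lipschitz_on_def)
  show ?thesis
  proof (rule lipschitz_onI)
    fix s t :: real assume st: "s \<in> {0..}" "t \<in> {0..}"
    obtain n where "max s t / h \<le> real n" using real_arch_simple by blast
    then have "max s t \<le> real n * h" using h by (simp add: field_simps)
    then show "dist (pursuit K h x M s) (pursuit K h x M t) \<le> 1 * dist s t"
      using st by (intro lipschitz_onD[OF initial[of n]]) auto
  qed simp
qed

lemma pursuit_admissible: "admissible K x (pursuit K h x M)"
  using pursuit_in pursuit_lipschitz pursuit_at_grid[of 0] by (auto simp: admissible_def)

text \<open>
  As long as Man is at least \<open>\<epsilon> > h\<close> away, no step of Lion is cut short by reaching its target.
\<close>

lemma pursuit_wins: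
  assumes comp: "compact K" and conv: "convex_metric K" and "h < \<epsilon>"
  shows "\<exists>t\<ge>0. dist (pursuit K h x M t) (M t) < \<epsilon>"
proof (rule ccontr)
  assume "\<not> ?thesis"
  then have far: "\<epsilon> \<le> dist (pursuit_point K h x M i) (M (real i * h))" for i
    using h pursuit_at_grid[of i] by (metis less_imp_le mult_nonneg_nonneg not_less of_nat_0_le_iff)
  then have full: "min h (dist (pursuit_point K h x M i) (M (real i * h))) = h" for i
    using \<open>h < \<epsilon>\<close> by (smt (verit))
  show False
  proof (rule no_endless_pursuit[OF comp geo conv pursuit_point_in man_grid_in h \<open>h < \<epsilon>\<close> far])
    fix i
    show "dist (pursuit_point K h x M i) (pursuit_point K h x M (Suc i)) \<le> h"
      using dist_walk_start[OF geo pursuit_point_in man_grid_in, of h i i] h by simp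
    show "dist (pursuit_point K h x M (Suc i)) (M (real i * h)) =
        dist (pursuit_point K h x M i) (M (real i * h)) - h"
      using dist_walk_end[OF geo pursuit_point_in man_grid_in, of h i i] h full by simp
    have "1-lipschitz_on {0..} M" using M by (simp add: admissible_def)
    from lipschitz_onD[OF this, of "real i * h" "real (Suc i) * h"]
    show "dist (M (real i * h)) (M (real (Suc i) * h)) \<le> h"
      using h by (simp add: dist_real_def algebra_simps)
  qed
qed

end

lemma pursuit_point_cong:
  assumes "\<And>j. j < i \<Longrightarrow> M (real j * h) = M' (real j * h)"
  shows "pursuit_point K h x M i = pursuit_point K h x M' i"
  using assms by (induction i) auto

text \<open>
  During the step from \<open>j h\<close> to \<open>(j + 1) h\<close> Lion's position depends on Man's trajectory only
  through its values at the times \<open>0, h, \<dots>, j h\<close>.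
\<close>

lemma pursuit_strategy:
  assumes geo: "geodesic_space K" and h: "0 < h"
  shows "discrete_time_strategy K h (pursuit K h)"
  unfolding discrete_time_strategy_def
proof (intro conjI ballI allI impI)
  fix x y y' M M' t and i :: nat
  assume x: "x \<in> K" and M: "admissible K y M" and M': "admissible K y' M'"
    and eq: "\<forall>t\<in>{0..real i * h}. M t = M' t" and t: "t \<in> {0..(real i + 1) * h}"
  from t obtain j where j: "j \<le> i" "real j * h \<le> t" "t \<le> (real j + 1) * h"
    using grid_interval_cover[OF h, of t i] by auto
  have "M (real k * h) = M' (real k * h)" if "k \<le> j" for k
    using eq that j(1) h by (auto intro: mult_right_mono)
  then show "pursuit K h x M t = pursuit K h x M' t"
    using pursuit_on_step[OF geo h x M j(2,3)] pursuit_on_step[OF geo h x M' j(2,3)]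
      pursuit_point_cong[of j M h M' K x] by simp
qed (use pursuit_admissible[OF geo h] h in auto)

theorem corollary1:
  fixes K :: "'a::metric_space set"
  assumes "compact K"
    and "geodesic_space K"
    and "convex_metric K"
  shows "\<forall>\<epsilon>>0. \<exists>h \<Lambda>. discrete_time_strategy K h \<Lambda> \<and>
    (\<forall>x0\<in>K. \<forall>y0\<in>K. \<forall>M. admissible K y0 M \<longrightarrow>
       (\<exists>t\<ge>0. dist (\<Lambda> x0 M t) (M t) < \<epsilon>))"
proof (intro allI impI)
  fix \<epsilon> :: real assume \<epsilon>: "\<epsilon> > 0"
  show "\<exists>h \<Lambda>. discrete_time_strategy K h \<Lambda> \<and>
    (\<forall>x0\<in>K. \<forall>y0\<in>K. \<forall>M. admissible K y0 M \<longrightarrow>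
       (\<exists>t\<ge>0. dist (\<Lambda> x0 M t) (M t) < \<epsilon>))"
  proof (rule exI[of _ "\<epsilon> / 2"], rule exI[of _ "pursuit K (\<epsilon> / 2)"],
      intro conjI ballI allI impI)
    show "discrete_time_strategy K (\<epsilon> / 2) (pursuit K (\<epsilon> / 2))"
      using pursuit_strategy[OF assms(2)] \<epsilon> by simp
    fix x0 y0 M assume "x0 \<in> K" "admissible K y0 M"
    then show "\<exists>t\<ge>0. dist (pursuit K (\<epsilon> / 2) x0 M t) (M t) < \<epsilon>"
      using pursuit_wins[OF assms(2) _ _ _ assms(1,3)] \<epsilon> by simp
  qed
qed

end
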